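(* Let $1<\alpha<2$, $d\in(0,1-\frac1\alpha)$, $1<p<\alpha$, and let $g:\mathbb{R}\to\mathbb{R}$ be a measurable function such that $g(t)=0$ for all $t<0$ and $|g(t)|\le Ce^{-ct}$ for some constants $C>0$ and $c>0$. Let $Y_d(t)=\int_{-\infty}^{t}(I_+^dg)(t-x)\,dL_\alpha(x)$, $t\in\mathbb{R}$, be the FIMA Stable process. For the natural times $t_j=j$, $j\in\mathbb{N}=\{1,2,\dots\}$, let $S_n=\sum_{j=1}^nY_d(t_j)=\sum_{j=1}^nY_d(j)$. Then $$\frac{S_n}{n}\to0\quad\text{as }n\to\infty,\text{ in the }L^p(\Omega,\mathbb P)\text{ sense}.$$
   Context: $\{L_\alpha(t)\}_{t\in\mathbb{R}}$ is a symmetric $\alpha$-stable ($S\alpha S$) process with Lebesgue control measure on a probability space $(\Omega,\mathcal F,\mathbb P)$. The stable integral $f\mapsto\int_{\mathbb{R}}f\,dL_\alpha$ is the associated linear map from $L^\alpha(\mathbb{R})$ to random variables, with $\mathbb{E}[\exp\{i\theta\int f\,dL_\alpha\}]=\exp\{-|\theta|^\alpha\int_{\mathbb{R}}|f(x)|^\alpha dx\}$ for $\theta\in\mathbb{R}$; and $\int_{-\infty}^tf\,dL_\alpha$ means $\int_{\mathbb{R}}\mathbf 1_{(-\infty,t]}f\,dL_\alpha$. The left-sided Riemann-Liouville fractional integral is $(I_+^dg)(x)=\frac1{\Gamma(d)}\int_{-\infty}^xg(t)(x-t)^{d-1}dt$. *)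

theory Defs
  imports "HOL-Probability.Probability"
begin

text \<open>
  Functions (not equivalence classes) with finite absolute moment of order \<open>p\<close>.  It serves both
  for \<open>L\<^sup>\<alpha>(\<real>)\<close>, with \<open>M = lebesgue\<close>, and for \<open>L\<^sup>p(\<Omega>, P)\<close>.
\<close>

definition Lp_fun :: "'a measure \<Rightarrow> real \<Rightarrow> ('a \<Rightarrow> real) set" where
  "Lp_fun M p = {f \<in> borel_measurable M. integrable M (\<lambda>x. \<bar>f x\<bar> powr p)}"

text \<open>
  Membership in \<open>Lp_fun\<close> is demanded explicitly because the Bochner integral of a
  non-integrable function is \<open>0\<close>.
\<close>

definition tendsto_Lp ::
    "'a measure \<Rightarrow> real \<Rightarrow> (nat \<Rightarrow> 'a \<Rightarrow> real) \<Rightarrow> ('a \<Rightarrow> real) \<Rightarrow> bool" where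
  "tendsto_Lp M p X Z \<longleftrightarrow>
     (\<forall>n. X n \<in> Lp_fun M p) \<and> Z \<in> Lp_fun M p \<and>
     (\<lambda>n. (\<integral>\<omega>. \<bar>X n \<omega> - Z \<omega>\<bar> powr p \<partial>M) powr (1 / p)) \<longlonglongrightarrow> 0"

text \<open>
  The symmetric \<open>\<alpha>\<close>-stable process with Lebesgue control measure (stable Levy motion indexed by
  the whole line): independent increments, the increment over \<open>(s, t]\<close> being symmetric
  \<open>\<alpha>\<close>-stable with scale \<open>(t - s)\<^bsup>1/\<alpha>\<^esup>\<close>.
\<close>

definition SaS_process :: "'a measure \<Rightarrow> real \<Rightarrow> (real \<Rightarrow> 'a \<Rightarrow> real) \<Rightarrow> bool" where
  "SaS_process M \<alpha> L \<longleftrightarrow>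
     (\<forall>t. L t \<in> borel_measurable M) \<and>
     (AE \<omega> in M. L 0 \<omega> = 0) \<and>
     (\<forall>(n::nat) (\<tau>::nat \<Rightarrow> real). strict_mono_on {..n} \<tau> \<longrightarrow>
        prob_space.indep_vars M (\<lambda>_. borel) (\<lambda>i \<omega>. L (\<tau> (Suc i)) \<omega> - L (\<tau> i) \<omega>) {..<n}) \<and>
     (\<forall>s t \<theta>. s < t \<longrightarrow>
        (\<integral>\<omega>. iexp (\<theta> * (L t \<omega> - L s \<omega>)) \<partial>M) = complex_of_real (exp (- (\<bar>\<theta>\<bar> powr \<alpha> * (t - s)))))"

text \<open>
  \<open>J f\<close> plays the role of \<open>\<integral> f dL\<^sub>\<alpha>\<close>.  Random variables are identified up to null sets, so
  linearity, and the fact that \<open>J\<close> integrates the increments of \<open>L\<close>, hold almost surely.  By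
  linearity and the formula for the characteristic function, \<open>J f\<close> depends up to null sets only
  on the class of \<open>f\<close> in \<open>L\<^sup>\<alpha>(\<real>)\<close>, and \<open>L\<close> determines \<open>J\<close> (up to null sets) on \<open>L\<^sup>\<alpha>(\<real>)\<close>; no
  condition is put on \<open>J\<close> outside that space.
\<close>

definition stable_integral ::
    "'a measure \<Rightarrow> real \<Rightarrow> (real \<Rightarrow> 'a \<Rightarrow> real) \<Rightarrow> ((real \<Rightarrow> real) \<Rightarrow> 'a \<Rightarrow> real) \<Rightarrow> bool" where
  "stable_integral M \<alpha> L J \<longleftrightarrow>
     (\<forall>f \<in> Lp_fun lebesgue \<alpha>. J f \<in> borel_measurable M) \<and>
     (\<forall>s t. s < t \<longrightarrow> (AE \<omega> in M. J (indicator {s<..t}) \<omega> = L t \<omega> - L s \<omega>)) \<and>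
     (\<forall>f \<in> Lp_fun lebesgue \<alpha>. \<forall>h \<in> Lp_fun lebesgue \<alpha>. \<forall>a b.
        AE \<omega> in M. J (\<lambda>x. a * f x + b * h x) \<omega> = a * J f \<omega> + b * J h \<omega>) \<and>
     (\<forall>f \<in> Lp_fun lebesgue \<alpha>. \<forall>\<theta>.
        (\<integral>\<omega>. iexp (\<theta> * J f \<omega>) \<partial>M) =
        complex_of_real (exp (- (\<bar>\<theta>\<bar> powr \<alpha> * (\<integral>x. \<bar>f x\<bar> powr \<alpha> \<partial>lebesgue)))))"

definition RL_integral :: "real \<Rightarrow> (real \<Rightarrow> real) \<Rightarrow> real \<Rightarrow> real" where
  "RL_integral d g x = 1 / Gamma d * (LINT t:{..x}|lebesgue. g t * (x - t) powr (d - 1))"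

definition FIMA_stable ::
    "((real \<Rightarrow> real) \<Rightarrow> 'a \<Rightarrow> real) \<Rightarrow> real \<Rightarrow> (real \<Rightarrow> real) \<Rightarrow> real \<Rightarrow> 'a \<Rightarrow> real" where
  "FIMA_stable J d g t = J (\<lambda>x. indicator {..t} x * RL_integral d g (t - x))"

end

theory Submission
  imports Defs
begin

text \<open>
  Up to a constant, \<open>\<bar>x\<bar> powr p\<close> is the integral of \<open>(1 - cos (\<theta> * x)) * \<theta> powr (- p - 1)\<close> over
  \<open>\<theta> > 0\<close>.  By Tonelli, the characteristic function of \<open>J h\<close> therefore bounds \<open>E \<bar>J h\<bar> powr p\<close> by
  a multiple of the \<open>p\<close>-th power of the \<open>L\<^sup>\<alpha>\<close>-norm of \<open>h\<close>, and since \<open>J\<close> is linear it suffices that the averages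
  of the translates \<open>\<lambda>x. k (j - x)\<close> of the kernel \<open>k = RL_integral d g\<close> tend to \<open>0\<close> in \<open>L\<^sup>\<alpha>\<close>.
  The kernel vanishes on the negative axis and is \<open>O((1 + u) powr (d - 1))\<close>, and as \<open>(1 - d) * \<alpha> > 1\<close>
  there is \<open>\<beta> < \<alpha>\<close> with \<open>(1 - d) * \<beta> > 1\<close>.  The averages are bounded in \<open>L\<^sup>\<beta>\<close> and tend to \<open>0\<close>
  uniformly, hence tend to \<open>0\<close> in \<open>L\<^sup>\<alpha>\<close>.
\<close>

text \<open>For a nonnegative integrand gauge integrability is absolute integrability. The
  closed-form integrals of powers and exponentials used below pass through this bridge.\<close>

lemma has_bochner_integral_lborel_nonneg:
  fixes f :: "real \<Rightarrow> real"
  assumes "(f has_integral I) S" "\<And>x. x \<in> S \<Longrightarrow> 0 \<le> f x"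
    and [measurable]: "f \<in> borel_measurable borel" "S \<in> sets borel"
  shows "has_bochner_integral lborel (\<lambda>x. indicator S x * f x) I"
proof (rule has_bochner_integral_nn_integral)
  show "0 \<le> I" using has_integral_nonneg assms by blast
  show "(\<integral>\<^sup>+ x. ennreal (indicator S x * f x) \<partial>lborel) = ennreal I"
    using nn_integral_has_integral_lebesgue[OF assms(2,1)] .
qed (use assms in \<open>auto split: split_indicator\<close>)

subsection \<open>Absolute moments of stable variables\<close>

text \<open>It is enough to keep the frequencies between \<open>1 / \<bar>x\<bar>\<close> and
  \<open>2 / \<bar>x\<bar>\<close>. There \<open>\<theta> * \<bar>x\<bar>\<close> lies in
  \<open>{1..2}\<close>, so the cosine is at most \<open>cos 1\<close>, the weight is at least its
  value at the right endpoint, and the interval has length \<open>1 / \<bar>x\<bar>\<close>.\<close>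

lemma abs_powr_le_nn_integral_one_minus_cos:
  fixes x p :: real
  assumes "0 < p"
  shows "ennreal ((1 - cos 1) * 2 powr (- p - 1) * \<bar>x\<bar> powr p)
    \<le> (\<integral>\<^sup>+\<theta>. ennreal (indicator {0<..} \<theta> * ((1 - cos (\<theta> * x)) * \<theta> powr (- p - 1))) \<partial>lborel)"
proof (cases "x = 0")
  case False
  define I where "I = {1 / \<bar>x\<bar> .. 2 / \<bar>x\<bar>}"
  define b where "b = (1 - cos 1) * (2 / \<bar>x\<bar>) powr (- p - 1)"
  have pos: "1 / \<bar>x\<bar> > 0" using False by simp
  have "b * measure lborel I = (1 - cos 1) * 2 powr (- p - 1) * \<bar>x\<bar> powr p"
    using False pos
    by (simp add: b_def I_def powr_divide powr_minus powr_diff powr_add field_simps)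
  then have "ennreal ((1 - cos 1) * 2 powr (- p - 1) * \<bar>x\<bar> powr p)
      = (\<integral>\<^sup>+\<theta>. ennreal b * indicator I \<theta> \<partial>lborel)"
    using pos by (subst nn_integral_cmult_indicator)
      (auto simp: b_def I_def divide_right_mono simp flip: ennreal_mult'')
  also have "\<dots> \<le> (\<integral>\<^sup>+\<theta>. ennreal (indicator {0<..} \<theta> * ((1 - cos (\<theta> * x)) * \<theta> powr (- p - 1))) \<partial>lborel)"
  proof (rule nn_integral_mono)
    fix \<theta> :: real
    show "ennreal b * indicator I \<theta>
      \<le> ennreal (indicator {0<..} \<theta> * ((1 - cos (\<theta> * x)) * \<theta> powr (- p - 1)))"
    proof (cases "\<theta> \<in> I")
      case True
      then have \<theta>: "1 / \<bar>x\<bar> \<le> \<theta>" "\<theta> \<le> 2 / \<bar>x\<bar>" by (auto simp: I_def)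
      then have "0 < \<theta>" using pos by linarith
      have "1 \<le> \<theta> * \<bar>x\<bar>" "\<theta> * \<bar>x\<bar> \<le> 2" using \<theta> False by (auto simp: field_simps)
      \<comment> \<open>The cosine decreases on \<open>{0..pi}\<close>, and 2 is below
        \<open>pi\<close>.\<close>
      then have "cos (\<theta> * \<bar>x\<bar>) \<le> cos 1"
        using pi_gt3 by (subst cos_mono_le_eq) auto
      moreover have "cos (\<theta> * \<bar>x\<bar>) = cos (\<theta> * x)" by (cases "x \<ge> 0") auto
      moreover have "(2 / \<bar>x\<bar>) powr (- p - 1) \<le> \<theta> powr (- p - 1)"
        using \<theta> \<open>0 < \<theta>\<close> assms by (intro powr_mono2') auto
      ultimately have "b \<le> (1 - cos (\<theta> * x)) * \<theta> powr (- p - 1)"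
        unfolding b_def by (intro mult_mono) auto
      then show ?thesis using True \<open>0 < \<theta>\<close> by (simp add: ennreal_leI)
    qed simp
  qed
  finally show ?thesis .
qed simp

text \<open>Since \<open>1 - exp (- z) \<le> min 1 z\<close> for \<open>z \<ge> 0\<close>, the
  integrand has two majorants, which exchange roles where \<open>\<theta> * \<sigma> = 1\<close>.
  The bound by \<open>z\<close> is integrable near 0 because \<open>p < \<alpha>\<close>, the bound
  by 1 near infinity because \<open>p > 0\<close>.\<close>

lemma nn_integral_one_minus_exp_powr_le:
  fixes \<alpha> p \<sigma> :: real
  assumes "0 < p" "p < \<alpha>" "0 \<le> \<sigma>"
  shows "(\<integral>\<^sup>+\<theta>. ennreal (indicator {0<..} \<theta> *
      ((1 - exp (- (\<bar>\<theta>\<bar> powr \<alpha> * \<sigma> powr \<alpha>))) * \<theta> powr (- p - 1))) \<partial>lborel)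
    \<le> ennreal ((1 / (\<alpha> - p) + 1 / p) * \<sigma> powr p)"
proof (cases "\<sigma> = 0")
  case False
  with assms have "\<sigma> > 0" by simp
  \<comment> \<open>The two majorants, each cut off at \<open>1 / \<sigma>\<close>. The shared
    endpoint is harmless, because only the upper bound \<open>u + v\<close> is used.\<close>
  define u where "u = (\<lambda>\<theta>. indicator {0..1/\<sigma>} \<theta> * (\<sigma> powr \<alpha> * \<theta> powr (\<alpha> - p - 1)))"
  define v where "v = (\<lambda>\<theta>::real. indicator {1/\<sigma>..} \<theta> * \<theta> powr (- p - 1))"
  have "((\<lambda>\<theta>. \<sigma> powr \<alpha> * \<theta> powr (\<alpha> - p - 1)) has_integral
      \<sigma> powr \<alpha> * ((1/\<sigma>) powr ((\<alpha> - p - 1) + 1) / ((\<alpha> - p - 1) + 1))) {0..1/\<sigma>}"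
    using assms by (intro has_integral_mult_right has_integral_powr_from_0) auto
  then have "has_bochner_integral lborel u
      (\<sigma> powr \<alpha> * ((1/\<sigma>) powr ((\<alpha> - p - 1) + 1) / ((\<alpha> - p - 1) + 1)))"
    unfolding u_def by (rule has_bochner_integral_lborel_nonneg) auto
  also have "\<sigma> powr \<alpha> * ((1/\<sigma>) powr ((\<alpha> - p - 1) + 1) / ((\<alpha> - p - 1) + 1)) = \<sigma> powr p / (\<alpha> - p)"
    using \<open>\<sigma> > 0\<close> assms by (simp add: powr_divide powr_diff)
  finally have u: "has_bochner_integral lborel u (\<sigma> powr p / (\<alpha> - p))" .
  have "((\<lambda>\<theta>. \<theta> powr (- p - 1)) has_integral
      - ((1/\<sigma>) powr ((- p - 1) + 1)) / ((- p - 1) + 1)) {1/\<sigma>..}"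
    using assms \<open>\<sigma> > 0\<close> by (intro has_integral_powr_to_inf) auto
  then have "has_bochner_integral lborel v (- ((1/\<sigma>) powr ((- p - 1) + 1)) / ((- p - 1) + 1))"
    unfolding v_def by (rule has_bochner_integral_lborel_nonneg) auto
  also have "- ((1/\<sigma>) powr ((- p - 1) + 1)) / ((- p - 1) + 1) = \<sigma> powr p / p"
    using \<open>\<sigma> > 0\<close> assms by (simp add: powr_divide powr_minus field_simps)
  finally have v: "has_bochner_integral lborel v (\<sigma> powr p / p)" .
  have "(\<integral>\<^sup>+\<theta>. ennreal (indicator {0<..} \<theta> *
      ((1 - exp (- (\<bar>\<theta>\<bar> powr \<alpha> * \<sigma> powr \<alpha>))) * \<theta> powr (- p - 1))) \<partial>lborel)
    \<le> (\<integral>\<^sup>+\<theta>. ennreal (u \<theta> + v \<theta>) \<partial>lborel)"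
  proof (intro nn_integral_mono ennreal_leI)
    fix \<theta> :: real
    have nn: "u \<theta> \<ge> 0" "v \<theta> \<ge> 0" by (auto simp: u_def v_def)
    show "indicator {0<..} \<theta> * ((1 - exp (- (\<bar>\<theta>\<bar> powr \<alpha> * \<sigma> powr \<alpha>))) * \<theta> powr (- p - 1)) \<le> u \<theta> + v \<theta>"
    proof (cases "\<theta> > 0")
      case True
      have "1 - exp (- (\<theta> powr \<alpha> * \<sigma> powr \<alpha>)) \<le> \<theta> powr \<alpha> * \<sigma> powr \<alpha>"
        using exp_ge_add_one_self[of "- (\<theta> powr \<alpha> * \<sigma> powr \<alpha>)"] by simp
      then have "(1 - exp (- (\<theta> powr \<alpha> * \<sigma> powr \<alpha>))) * \<theta> powr (- p - 1)
          \<le> (\<theta> powr \<alpha> * \<sigma> powr \<alpha>) * \<theta> powr (- p - 1)"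
        by (rule mult_right_mono) auto
      also have "\<dots> = \<sigma> powr \<alpha> * \<theta> powr (\<alpha> - p - 1)"
        using True by (simp add: powr_add[symmetric] algebra_simps)
      finally have 1: "\<theta> \<le> 1/\<sigma> \<Longrightarrow> ?thesis" using True nn by (simp add: u_def)
      have 2: "(1 - exp (- (\<theta> powr \<alpha> * \<sigma> powr \<alpha>))) * \<theta> powr (- p - 1) \<le> \<theta> powr (- p - 1)"
        by (rule mult_left_le_one_le) auto
      have "?thesis" if "1/\<sigma> \<le> \<theta>"
      proof -
        have eqs: "indicator {0<..} \<theta> = (1::real)" "v \<theta> = \<theta> powr (- p - 1)" "\<bar>\<theta>\<bar> = \<theta>"
          using True that by (auto simp: v_def)
        show ?thesis using 2 nn(1) unfolding eqs by linarith
      qed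
      with 1 show ?thesis by linarith
    qed (use nn in simp)
  qed
  also have "\<dots> = ennreal (\<sigma> powr p / (\<alpha> - p) + \<sigma> powr p / p)"
    using has_bochner_integral_add[OF u v]
    by (subst nn_integral_eq_integral)
      (auto simp: has_bochner_integral_iff u_def v_def intro!: AE_I2 add_nonneg_nonneg)
  finally show ?thesis by (simp add: field_simps)
qed (use assms in simp)

text \<open>Taking expectations in the lower bound for the weighted cosine integral and exchanging
  integrals turns the cosine into the real part of the characteristic function, whose weighted
  integral is bounded above by the preceding estimate. \<open>K\<close> is the quotient of the two
  constants and does not depend on \<open>X\<close> or \<open>\<sigma>\<close>.\<close>

lemma (in prob_space) SaS_abs_moment:
  fixes \<alpha> p \<sigma> :: real
  assumes X[measurable]: "X \<in> borel_measurable M"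
    and p: "0 < p" "p < \<alpha>" and "0 \<le> \<sigma>"
    and char: "\<And>\<theta>. (\<integral>\<omega>. iexp (\<theta> * X \<omega>) \<partial>M) = complex_of_real (exp (- (\<bar>\<theta>\<bar> powr \<alpha> * \<sigma> powr \<alpha>)))"
  defines "K \<equiv> (1 / (\<alpha> - p) + 1 / p) / ((1 - cos 1) * 2 powr (- p - 1))"
  shows "integrable M (\<lambda>\<omega>. \<bar>X \<omega>\<bar> powr p)"
    and "(\<integral>\<omega>. \<bar>X \<omega>\<bar> powr p \<partial>M) \<le> K * \<sigma> powr p"
proof -
  define k where "k = (1 - cos 1) * 2 powr (- p - 1)"
  \<comment> \<open>Strict positivity of \<open>k\<close> allows it to be cancelled at the
    end.\<close>
  have "cos 1 < cos (0::real)" using pi_gt3 by (subst cos_mono_less_eq) auto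
  then have "k > 0" by (simp add: k_def)
  have cos: "(\<integral>\<omega>. 1 - cos (\<theta> * X \<omega>) \<partial>M) = 1 - exp (- (\<bar>\<theta>\<bar> powr \<alpha> * \<sigma> powr \<alpha>))" for \<theta>
  proof -
    have "integrable M (\<lambda>\<omega>. iexp (\<theta> * X \<omega>))"
      by (rule integrable_const_bound[where B = 1]) auto
    then have "Re (\<integral>\<omega>. iexp (\<theta> * X \<omega>) \<partial>M) = (\<integral>\<omega>. cos (\<theta> * X \<omega>) \<partial>M)"
      by (subst integral_Re[symmetric]) (auto simp: Re_exp)
    moreover have "integrable M (\<lambda>\<omega>. cos (\<theta> * X \<omega>))"
      by (rule integrable_const_bound[where B = 1]) auto
    moreover have "Re (\<integral>\<omega>. iexp (\<theta> * X \<omega>) \<partial>M) = exp (- (\<bar>\<theta>\<bar> powr \<alpha> * \<sigma> powr \<alpha>))"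
      by (simp only: char Re_complex_of_real)
    ultimately show ?thesis by (simp add: prob_space)
  qed
  have inn: "(\<integral>\<^sup>+\<omega>. ennreal (1 - cos (\<theta> * X \<omega>)) \<partial>M) = ennreal (1 - exp (- (\<bar>\<theta>\<bar> powr \<alpha> * \<sigma> powr \<alpha>)))" for \<theta>
  proof -
    have "integrable M (\<lambda>\<omega>. 1 - cos (\<theta> * X \<omega>))"
      by (intro Bochner_Integration.integrable_diff integrable_const_bound[where B = 1]) auto
    then show ?thesis by (subst nn_integral_eq_integral) (auto simp: cos)
  qed
  interpret pair_sigma_finite M lborel ..
  have "ennreal k * (\<integral>\<^sup>+\<omega>. ennreal (\<bar>X \<omega>\<bar> powr p) \<partial>M) = (\<integral>\<^sup>+\<omega>. ennreal (k * \<bar>X \<omega>\<bar> powr p) \<partial>M)"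
    using \<open>k > 0\<close> by (subst nn_integral_cmult[symmetric]) (auto simp: ennreal_mult)
  also have "\<dots> \<le> (\<integral>\<^sup>+\<omega>. (\<integral>\<^sup>+\<theta>. ennreal (indicator {0<..} \<theta> *
      ((1 - cos (\<theta> * X \<omega>)) * \<theta> powr (- p - 1))) \<partial>lborel) \<partial>M)"
    unfolding k_def by (intro nn_integral_mono abs_powr_le_nn_integral_one_minus_cos p)
  also have "\<dots> = (\<integral>\<^sup>+\<theta>. (\<integral>\<^sup>+\<omega>. ennreal (indicator {0<..} \<theta> *
      ((1 - cos (\<theta> * X \<omega>)) * \<theta> powr (- p - 1))) \<partial>M) \<partial>lborel)"
    by (rule Fubini'[symmetric]) measurable
  also have "\<dots> = (\<integral>\<^sup>+\<theta>. ennreal (indicator {0<..} \<theta> *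
      ((1 - exp (- (\<bar>\<theta>\<bar> powr \<alpha> * \<sigma> powr \<alpha>))) * \<theta> powr (- p - 1))) \<partial>lborel)"
  proof (rule nn_integral_cong)
    fix \<theta> :: real
    have "(\<integral>\<^sup>+\<omega>. ennreal (indicator {0<..} \<theta> * ((1 - cos (\<theta> * X \<omega>)) * \<theta> powr (- p - 1))) \<partial>M)
       = (\<integral>\<^sup>+\<omega>. ennreal (indicator {0<..} \<theta> * \<theta> powr (- p - 1)) * ennreal (1 - cos (\<theta> * X \<omega>)) \<partial>M)"
      by (intro nn_integral_cong) (auto simp: mult_ac simp flip: ennreal_mult)
    also have "\<dots> = ennreal (indicator {0<..} \<theta> * ((1 - exp (- (\<bar>\<theta>\<bar> powr \<alpha> * \<sigma> powr \<alpha>))) * \<theta> powr (- p - 1)))"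
      by (subst nn_integral_cmult) (auto simp: inn mult_ac simp flip: ennreal_mult)
    finally show "(\<integral>\<^sup>+\<omega>. ennreal (indicator {0<..} \<theta> * ((1 - cos (\<theta> * X \<omega>)) * \<theta> powr (- p - 1))) \<partial>M)
      = ennreal (indicator {0<..} \<theta> * ((1 - exp (- (\<bar>\<theta>\<bar> powr \<alpha> * \<sigma> powr \<alpha>))) * \<theta> powr (- p - 1)))" .
  qed
  also have "\<dots> \<le> ennreal ((1 / (\<alpha> - p) + 1 / p) * \<sigma> powr p)"
    using assms by (intro nn_integral_one_minus_exp_powr_le)
  also have "\<dots> = ennreal k * ennreal (K * \<sigma> powr p)"
    using \<open>k > 0\<close> p by (simp add: K_def k_def[symmetric] flip: ennreal_mult')
  \<comment> \<open>Cancelling the finite nonzero factor \<open>k\<close> leaves a finite bound,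
    which yields integrability as well as the estimate.\<close>
  finally have le: "(\<integral>\<^sup>+\<omega>. ennreal (\<bar>X \<omega>\<bar> powr p) \<partial>M) \<le> ennreal (K * \<sigma> powr p)"
    using \<open>k > 0\<close> by (simp add: ennreal_mult_le_mult_iff)
  then show int: "integrable M (\<lambda>\<omega>. \<bar>X \<omega>\<bar> powr p)"
    by (intro integrableI_bounded) (auto simp: le_less_trans)
  have "K \<ge> 0" unfolding K_def k_def[symmetric] using \<open>k > 0\<close> p by simp
  with int le show "(\<integral>\<omega>. \<bar>X \<omega>\<bar> powr p \<partial>M) \<le> K * \<sigma> powr p"
    by (subst (asm) nn_integral_eq_integral) auto
qed

subsection \<open>Averages of translates\<close>

text \<open>Young's inequality, applied to \<open>m powr (\<beta> - 1) * a j\<close> with \<open>m\<close> the mean, gives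
  \<open>m powr \<beta> \<le> (1 - 1/\<beta>) * m powr \<beta> + (\<Sum>j\<in>A. a j powr \<beta>) / (\<beta> * card A)\<close>.\<close>

lemma power_mean_powr:
  fixes a :: "'i \<Rightarrow> real"
  assumes "\<And>j. j \<in> A \<Longrightarrow> 0 \<le> a j" "1 < \<beta>"
  shows "((\<Sum>j\<in>A. a j) / card A) powr \<beta> \<le> (\<Sum>j\<in>A. a j powr \<beta>) / card A"
proof (cases "card A = 0")
  case False
  define m where "m = (\<Sum>j\<in>A. a j) / card A"
  have "m \<ge> 0" using assms(1) by (auto simp: m_def intro!: divide_nonneg_nonneg sum_nonneg)
  have young: "m powr (\<beta> - 1) * a j \<le> m powr \<beta> * (1 - 1/\<beta>) + a j powr \<beta> / \<beta>" if "j \<in> A" for j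
  proof -
    have "(m powr (\<beta> - 1)) powr (\<beta> / (\<beta> - 1)) = m powr \<beta>"
      using assms(2) by (simp add: powr_powr)
    then show ?thesis
      using Youngs_inequality[of "\<beta> / (\<beta> - 1)" \<beta> "m powr (\<beta> - 1)" "a j"] assms(1)[OF that] assms(2)
      by (simp add: field_simps)
  qed
  have "m powr \<beta> = m powr (\<beta> - 1) * m"
    using \<open>m \<ge> 0\<close> by (cases "m = 0") (auto simp: powr_diff)
  also have "\<dots> = (\<Sum>j\<in>A. m powr (\<beta> - 1) * a j) / card A"
    by (simp add: m_def sum_distrib_left)
  also have "\<dots> \<le> (\<Sum>j\<in>A. m powr \<beta> * (1 - 1/\<beta>) + a j powr \<beta> / \<beta>) / card A"
    using young by (intro divide_right_mono sum_mono) auto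
  also have "\<dots> = m powr \<beta> * (1 - 1/\<beta>) + (\<Sum>j\<in>A. a j powr \<beta>) / card A / \<beta>"
    using False by (simp add: sum.distrib sum_divide_distrib add_divide_distrib divide_divide_eq_left mult.commute)
  finally show ?thesis
    using assms(2) unfolding m_def[symmetric] by (simp add: field_simps)
qed simp

text \<open>The power mean inequality with an exponent \<open>\<beta>\<close> that makes
  \<open>real j powr - (a * \<beta>)\<close> summable bounds the average by
  \<open>(Z / real n) powr (1 / \<beta>)\<close>.\<close>

lemma average_powr_tendsto_0:
  fixes a :: real
  assumes "0 < a"
  shows "(\<lambda>n. (\<Sum>j=1..n. real j powr - a) / real n) \<longlonglongrightarrow> 0"
proof -
  \<comment> \<open>With this choice \<open>a * \<beta> = a + 1\<close>.\<close>
  define \<beta> where "\<beta> = 1 + 1 / a"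
  have \<beta>: "1 < \<beta>" "- (a * \<beta>) < - 1" using assms by (auto simp: \<beta>_def field_simps)
  \<comment> \<open>The series starts at \<open>j = 0\<close>, but that term is 0 because
    \<open>0 powr _ = 0\<close>.\<close>
  define Z where "Z = (\<Sum>j. real j powr - (a * \<beta>))"
  have sm: "summable (\<lambda>j. real j powr - (a * \<beta>))"
    using \<beta> by (subst summable_real_powr_iff)
  have bound: "(\<Sum>j=1..n. real j powr - a) / real n \<le> (Z / real n) powr (1 / \<beta>)" for n
  proof -
    have "((\<Sum>j=1..n. real j powr - a) / real n) powr \<beta> \<le> (\<Sum>j=1..n. (real j powr - a) powr \<beta>) / real n"
      using power_mean_powr[of "{1..n}" "\<lambda>j. real j powr - a" \<beta>] \<beta> by simp
    also have "\<dots> \<le> Z / real n"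
      unfolding Z_def by (intro divide_right_mono) (auto simp: powr_powr intro!: sum_le_suminf sm)
    finally have "(((\<Sum>j=1..n. real j powr - a) / real n) powr \<beta>) powr (1 / \<beta>) \<le> (Z / real n) powr (1 / \<beta>)"
      using \<beta> by (intro powr_mono2) auto
    then show ?thesis using \<beta> by (simp add: powr_powr sum_nonneg)
  qed
  have "(\<lambda>n. (Z / real n) powr (1 / \<beta>)) \<longlonglongrightarrow> 0"
  proof (rule tendsto_zero_powrI[OF lim_const_over_n tendsto_const])
    have "Z \<ge> 0" unfolding Z_def by (intro suminf_nonneg sm) auto
    then show "\<forall>\<^sub>F n in sequentially. 0 \<le> Z / real n" by simp
  qed (use \<beta> in simp)
  then show ?thesis
    by (rule real_tendsto_sandwich[OF _ _ tendsto_const, rotated 2]) (use bound in \<open>auto simp: sum_nonneg simp del: One_nat_def\<close>)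
qed

text \<open>The bound is uniform in \<open>x\<close>. If \<open>x \<le> 1\<close>, then
  \<open>1 + (j - x) \<ge> j\<close> and the terms compare one by one. If \<open>x > 1\<close>, the
  first term vanishes, and the others form a shorter sum of the same kind with \<open>x - 1\<close>
  in place of \<open>x\<close>; hence the induction over arbitrary \<open>x\<close>.\<close>

lemma sum_translates_le:
  fixes w :: "real \<Rightarrow> real"
  assumes w0: "\<And>u. u < 0 \<Longrightarrow> w u = 0" and w: "\<And>u. 0 \<le> u \<Longrightarrow> w u \<le> K * (1 + u) powr - a"
    and "0 \<le> K" "0 < a"
  shows "(\<Sum>j=1..n. w (real j - x)) \<le> K * (\<Sum>j=1..n. real j powr - a)"
proof (induction n arbitrary: x)
  case (Suc n)
  show ?case
  proof (cases "x \<le> 1")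
    case True
    have "w (real j - x) \<le> K * real j powr - a" if "j \<in> {1..Suc n}" for j
    proof -
      have "w (real j - x) \<le> K * (1 + (real j - x)) powr - a"
        using that True by (intro w) auto
      also have "\<dots> \<le> K * real j powr - a"
        using that True assms by (intro mult_left_mono powr_mono2') auto
      finally show ?thesis .
    qed
    then show ?thesis by (simp only: sum_distrib_left sum_mono)
  next
    case False
    have "(\<Sum>j=1..Suc n. w (real j - x)) = w (1 - x) + (\<Sum>j=Suc 1..Suc n. w (real j - x))"
      by (subst sum.atLeast_Suc_atMost) (simp_all del: sum.cl_ivl_Suc)
    also have "(\<Sum>j=Suc 1..Suc n. w (real j - x)) = (\<Sum>j=1..n. w (real j - (x - 1)))"
      by (subst sum.shift_bounds_cl_Suc_ivl) (simp add: algebra_simps)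
    also have "w (1 - x) = 0" using False by (intro w0) auto
    also have "0 + (\<Sum>j=1..n. w (real j - (x - 1))) \<le> K * (\<Sum>j=1..n. real j powr - a)"
      using Suc.IH by simp
    also have "\<dots> \<le> K * (\<Sum>j=1..Suc n. real j powr - a)"
      using assms by (intro mult_left_mono) auto
    finally show ?thesis .
  qed
qed simp

context
  fixes k :: "real \<Rightarrow> real" and K a :: real
  assumes k_borel[measurable]: "k \<in> borel_measurable borel"
    and k_neg: "\<And>u. u < 0 \<Longrightarrow> k u = 0"
    and k_le: "\<And>u. 0 \<le> u \<Longrightarrow> \<bar>k u\<bar> \<le> K * (1 + u) powr - a"
    and K: "0 \<le> K" and a: "0 < a"
begin

text \<open>The majorant \<open>K powr \<beta> * (1 + u) powr - (a * \<beta>)\<close> on the half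
  line has finite integral because \<open>a * \<beta> > 1\<close>.\<close>

lemma integrable_kernel_powr:
  assumes "0 < \<beta>" "1 < a * \<beta>"
  shows "integrable lborel (\<lambda>u. \<bar>k u\<bar> powr \<beta>)"
proof -
  have "((\<lambda>u. u powr - (a * \<beta>)) has_integral - (1 powr (- (a * \<beta>) + 1)) / (- (a * \<beta>) + 1)) {1..}"
    using assms by (intro has_integral_powr_to_inf) auto
  then have "has_bochner_integral lborel (\<lambda>u. indicator {1..} u * u powr - (a * \<beta>))
      (- (1 powr (- (a * \<beta>) + 1)) / (- (a * \<beta>) + 1))"
    by (rule has_bochner_integral_lborel_nonneg) auto
  \<comment> \<open>Translation by 1; the form \<open>1 + 1 * u\<close> is that of the affine
    substitution rule.\<close>
  then have "integrable lborel (\<lambda>u::real. indicator {1..} (1 + 1 * u) * (1 + 1 * u) powr - (a * \<beta>))"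
    by (intro lborel_integrable_real_affine) (auto simp: has_bochner_integral_iff)
  then have "integrable lborel (\<lambda>u::real. K powr \<beta> * (indicator {1..} (1 + 1 * u) * (1 + 1 * u) powr - (a * \<beta>)))"
    by (rule integrable_mult_right)
  then show ?thesis
  proof (rule Bochner_Integration.integrable_bound)
    show "AE u in lborel. norm (\<bar>k u\<bar> powr \<beta>)
        \<le> norm (K powr \<beta> * (indicator {1..} (1 + 1 * u) * (1 + 1 * u) powr - (a * \<beta>)))"
    proof (rule AE_I2)
      fix u :: real
      show "norm (\<bar>k u\<bar> powr \<beta>)
        \<le> norm (K powr \<beta> * (indicator {1..} (1 + 1 * u) * (1 + 1 * u) powr - (a * \<beta>)))"
      proof (cases "u < 0")
        case False
        then have "\<bar>k u\<bar> powr \<beta> \<le> (K * (1 + u) powr - a) powr \<beta>"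
          using assms k_le by (intro powr_mono2) auto
        then show ?thesis using False K by (simp add: powr_mult powr_powr)
      qed (simp add: k_neg)
    qed
  qed measurable
qed

text \<open>Interpolation between the sup norm and \<open>L^\<beta>\<close>: of the exponent
  \<open>\<alpha>\<close>, the part \<open>\<alpha> - \<beta>\<close> is spent on the uniform bound
  \<open>\<epsilon> n\<close>, which tends to 0, and the part \<open>\<beta>\<close> on the power
  mean, whose integral is at most \<open>I\<close> because Lebesgue measure is invariant under
  reflection and translation.\<close>

lemma average_translates_tendsto_0:
  assumes "1 < \<alpha>" "1 < a * \<alpha>"
  shows "(\<lambda>n. \<integral>x. \<bar>(\<Sum>j=1..n. k (real j - x)) / real n\<bar> powr \<alpha> \<partial>lborel) \<longlonglongrightarrow> 0"
proof -
  \<comment> \<open>\<open>\<beta> > 1\<close> serves the power mean inequality,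
    \<open>\<beta> > 1 / a\<close> puts the kernel in \<open>L^\<beta>\<close>, and
    \<open>\<beta> < \<alpha>\<close> leaves a positive power of
    \<open>\<epsilon> n\<close>.\<close>
  have "max 1 (1 / a) < \<alpha>" using assms a by (simp add: field_simps)
  then obtain \<beta> where "max 1 (1 / a) < \<beta>" "\<beta> < \<alpha>" using dense by blast
  then have \<beta>: "1 < \<beta>" "\<beta> < \<alpha>" "1 / a < \<beta>" by auto
  then have "1 < a * \<beta>" using a by (simp add: field_simps)
  then have int_k: "integrable lborel (\<lambda>u. \<bar>k u\<bar> powr \<beta>)"
    using \<beta> by (intro integrable_kernel_powr) auto
  define I where "I = (\<integral>u. \<bar>k u\<bar> powr \<beta> \<partial>lborel)"
  define \<epsilon> where "\<epsilon> = (\<lambda>n. K * ((\<Sum>j=1..n. real j powr - a) / real n))"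
  have int_tr: "integrable lborel (\<lambda>x. \<bar>k (y - x)\<bar> powr \<beta>)" for y
    using lborel_integrable_real_affine[OF int_k, of "-1" y] by simp
  have I_tr: "(\<integral>x. \<bar>k (y - x)\<bar> powr \<beta> \<partial>lborel) = I" for y
    using lborel_integral_real_affine[of "-1" "\<lambda>u. \<bar>k u\<bar> powr \<beta>" y] by (simp add: I_def)
  have I_nn: "I \<ge> 0" by (simp add: I_def)
  have pt: "\<bar>(\<Sum>j=1..n. k (real j - x)) / real n\<bar> powr \<alpha>
      \<le> \<epsilon> n powr (\<alpha> - \<beta>) * ((\<Sum>j=1..n. \<bar>k (real j - x)\<bar> powr \<beta>) / real n)" for n x
  proof -
    define F where "F = (\<Sum>j=1..n. \<bar>k (real j - x)\<bar>) / real n"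
    have F0: "F \<ge> 0" by (simp add: F_def sum_nonneg)
    have "\<bar>\<Sum>j=1..n. k (real j - x)\<bar> \<le> (\<Sum>j=1..n. \<bar>k (real j - x)\<bar>)" by (rule sum_abs)
    then have "\<bar>(\<Sum>j=1..n. k (real j - x)) / real n\<bar> \<le> F"
      by (simp add: F_def divide_right_mono)
    then have "\<bar>(\<Sum>j=1..n. k (real j - x)) / real n\<bar> powr \<alpha> \<le> F powr \<alpha>"
      using assms by (intro powr_mono2) auto
    also have "\<dots> = F powr (\<alpha> - \<beta>) * F powr \<beta>" by (simp flip: powr_add)
    also have "\<dots> \<le> \<epsilon> n powr (\<alpha> - \<beta>) * ((\<Sum>j=1..n. \<bar>k (real j - x)\<bar> powr \<beta>) / real n)"
    proof (intro mult_mono powr_mono2)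
      show "F \<le> \<epsilon> n"
        unfolding F_def \<epsilon>_def times_divide_eq_right
        by (intro divide_right_mono sum_translates_le) (use k_neg k_le K a in auto)
      show "F powr \<beta> \<le> (\<Sum>j=1..n. \<bar>k (real j - x)\<bar> powr \<beta>) / real n"
        using power_mean_powr[of "{1..n}" "\<lambda>j. \<bar>k (real j - x)\<bar>" \<beta>] \<beta> by (simp add: F_def)
    qed (use \<beta> F0 in auto)
    finally show ?thesis .
  qed
  have le: "(\<integral>x. \<bar>(\<Sum>j=1..n. k (real j - x)) / real n\<bar> powr \<alpha> \<partial>lborel) \<le> \<epsilon> n powr (\<alpha> - \<beta>) * I" for n
  proof -
    have "(\<integral>x. \<bar>(\<Sum>j=1..n. k (real j - x)) / real n\<bar> powr \<alpha> \<partial>lborel)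
        \<le> (\<integral>x. \<epsilon> n powr (\<alpha> - \<beta>) * ((\<Sum>j=1..n. \<bar>k (real j - x)\<bar> powr \<beta>) / real n) \<partial>lborel)"
    proof (rule Bochner_Integration.integral_mono'[OF _ pt])
      show "0 \<le> \<epsilon> n powr (\<alpha> - \<beta>) * ((\<Sum>j=1..n. \<bar>k (real j - x)\<bar> powr \<beta>) / real n)" for x
        by (intro mult_nonneg_nonneg divide_nonneg_nonneg sum_nonneg) auto
    qed (intro integrable_mult_right integrable_divide Bochner_Integration.integrable_sum int_tr)
    also have "\<dots> = \<epsilon> n powr (\<alpha> - \<beta>) * ((\<Sum>j=1..n. I) / real n)"
      using int_tr by (simp add: I_tr)
    \<comment> \<open>The average of the constant \<open>I\<close> is \<open>I\<close>, except for
      \<open>n = 0\<close>, where division by zero gives 0.\<close>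
    also have "\<dots> \<le> \<epsilon> n powr (\<alpha> - \<beta>) * I"
      using I_nn by (cases "n = 0") auto
    finally show ?thesis .
  qed
  have "\<epsilon> \<longlonglongrightarrow> 0"
    unfolding \<epsilon>_def using tendsto_mult[OF tendsto_const average_powr_tendsto_0[OF a], of K] by simp
  then have "(\<lambda>n. \<epsilon> n powr (\<alpha> - \<beta>) * I) \<longlonglongrightarrow> 0"
    using \<beta> K by (intro tendsto_eq_intros | simp add: \<epsilon>_def sum_nonneg)+
  then show ?thesis
    by (rule real_tendsto_sandwich[OF _ _ tendsto_const, rotated 2]) (use le in \<open>auto simp del: One_nat_def abs_divide\<close>)
qed

end

subsection \<open>The kernel of the moving average\<close>

text \<open>A Borel function \<open>g'\<close> equal to \<open>g\<close> almost everywhere gives the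
  same integrals, and an integral of a jointly Borel function is Borel in its parameter. Writing the
  domain as the condition \<open>t \<le> x\<close> exposes this joint measurability.\<close>

lemma borel_measurable_RL_integral:
  assumes "g \<in> borel_measurable lebesgue"
  shows "RL_integral d g \<in> borel_measurable borel"
proof -
  obtain g' where g'[measurable]: "g' \<in> borel_measurable lborel" and eq: "AE t in lborel. g t = g' t"
    using completion_ex_borel_measurable_real[OF assms] by blast
  have "RL_integral d g x = 1 / Gamma d * (\<integral>t. (if t \<le> x then g' t * (x - t) powr (d - 1) else 0) \<partial>lborel)" for x
  proof -
    have [measurable]: "g \<in> borel_measurable lebesgue" by fact
    have [measurable]: "g' \<in> borel_measurable lebesgue" using g' by (rule measurable_completion)
    have "(LINT t:{..x}|lebesgue. g t * (x - t) powr (d - 1))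
        = (\<integral>t. (if t \<le> x then g' t * (x - t) powr (d - 1) else 0) \<partial>lebesgue)"
      unfolding set_lebesgue_integral_def
    proof (rule integral_cong_AE)
      have [measurable]: "(\<lambda>t. (x - t) powr (d - 1)) \<in> borel_measurable lebesgue"
        by (rule measurable_completion) measurable
      have [measurable]: "{..x} \<in> sets lebesgue" by simp
      show "(\<lambda>t. indicator {..x} t *\<^sub>R (g t * (x - t) powr (d - 1))) \<in> borel_measurable lebesgue"
        by measurable
      show "(\<lambda>t. if t \<le> x then g' t * (x - t) powr (d - 1) else 0) \<in> borel_measurable lebesgue"
        by (rule measurable_completion) (use g' in measurable)
      show "AE t in lebesgue. indicator {..x} t *\<^sub>R (g t * (x - t) powr (d - 1))
          = (if t \<le> x then g' t * (x - t) powr (d - 1) else 0)"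
        using AE_completion[OF eq] by eventually_elim auto
    qed
    also have "\<dots> = (\<integral>t. (if t \<le> x then g' t * (x - t) powr (d - 1) else 0) \<partial>lborel)"
      using g' by (intro integral_completion) measurable
    finally show ?thesis by (simp add: RL_integral_def)
  qed
  then have "RL_integral d g = (\<lambda>x. 1 / Gamma d * (\<integral>t. (if t \<le> x then g' t * (x - t) powr (d - 1) else 0) \<partial>lborel))"
    by blast
  moreover have "(\<lambda>x. 1 / Gamma d * (\<integral>t. (if t \<le> x then g' t * (x - t) powr (d - 1) else 0) \<partial>lborel))
      \<in> borel_measurable borel"
    by measurable
  ultimately show ?thesis by simp
qed

lemma RL_integral_neg:
  assumes "\<forall>t<0. g t = 0" "x < 0"
  shows "RL_integral d g x = 0"
proof -
  have "indicator {..x} t *\<^sub>R (g t * (x - t) powr (d - 1)) = 0" for t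
    using assms by (cases "t \<le> x") auto
  then show ?thesis by (simp add: RL_integral_def set_lebesgue_integral_def del: real_scaleR_def scaleR_eq_0_iff mult_eq_0_iff)
qed

text \<open>With \<open>s = x - t\<close> this extracts the decay
  \<open>(1 + x) powr (d - 1)\<close> from the fractional kernel. By
  \<open>1 + s + t \<le> (1 + s) * (1 + t)\<close> the price is a factor linear in \<open>t\<close>,
  which the exponential decay of \<open>g\<close> can absorb; the singularity at
  \<open>s = 0\<close> stays integrable.\<close>

lemma powr_convolution_split:
  fixes d s t :: real
  assumes "0 < d" "d < 1" "0 \<le> s" "0 \<le> t"
  shows "s powr (d - 1)
    \<le> (1 + (s + t)) powr (d - 1) * (2 * (1 + t) * (1 + indicator {0..1} s * s powr (d - 1)))"
proof (cases "s = 0")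
  case False
  with assms have "s > 0" by simp
  have "(1 + (s + t)) powr (1 - d) \<le> ((1 + t) * (1 + s)) powr (1 - d)"
    using assms by (intro powr_mono2) (auto simp: algebra_simps)
  also have "\<dots> = (1 + t) powr (1 - d) * (1 + s) powr (1 - d)"
    using assms by (simp add: powr_mult)
  also have "\<dots> \<le> (1 + t) powr 1 * (1 + s) powr (1 - d)"
    using assms by (intro mult_right_mono powr_mono) auto
  finally have 1: "(1 + (s + t)) powr (1 - d) \<le> (1 + t) * (1 + s) powr (1 - d)"
    using assms by simp
  have two: "(2::real) powr (1 - d) \<le> 2" using powr_mono[of "1 - d" 1 "2::real"] assms by simp
  \<comment> \<open>For \<open>s \<le> 1\<close> use \<open>1 + s \<le> 2\<close>, which leaves the
    singularity; for \<open>s > 1\<close> use \<open>1 + s \<le> 2 * s\<close>, which cancels the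
    power.\<close>
  have 2: "(1 + s) powr (1 - d) * s powr (d - 1) \<le> 2 * (1 + indicator {0..1} s * s powr (d - 1))"
  proof (cases "s \<le> 1")
    case True
    have "(1 + s) powr (1 - d) \<le> 2 powr (1 - d)"
      using True assms by (intro powr_mono2) auto
    then have "(1 + s) powr (1 - d) * s powr (d - 1) \<le> 2 * s powr (d - 1)"
      using two by (intro mult_right_mono) auto
    then show ?thesis using True assms by simp
  next
    case False
    have "(1 + s) powr (1 - d) \<le> (2 * s) powr (1 - d)"
      using False assms by (intro powr_mono2) auto
    also have "\<dots> \<le> 2 * s powr (1 - d)"
      using two by (simp add: powr_mult mult_right_mono)
    finally have "(1 + s) powr (1 - d) * s powr (d - 1) \<le> 2 * s powr (1 - d) * s powr (d - 1)"
      by (rule mult_right_mono) auto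
    also have "\<dots> = 2" using \<open>s > 0\<close> by (simp add: powr_add[symmetric])
    finally show ?thesis using False by simp
  qed
  have inv: "(1 + (s + t)) powr (d - 1) * (1 + (s + t)) powr (1 - d) = 1"
    using assms by (simp add: powr_add[symmetric])
  have "s powr (d - 1) = (1 + (s + t)) powr (d - 1) * ((1 + (s + t)) powr (1 - d) * s powr (d - 1))"
    using inv by (simp add: mult.assoc[symmetric])
  also have "\<dots> \<le> (1 + (s + t)) powr (d - 1) * ((1 + t) * (1 + s) powr (1 - d) * s powr (d - 1))"
    using 1 by (intro mult_left_mono mult_right_mono) auto
  also have "\<dots> \<le> (1 + (s + t)) powr (d - 1) * ((1 + t) * (2 * (1 + indicator {0..1} s * s powr (d - 1))))"
    unfolding mult.assoc using 2 assms by (intro mult_left_mono) auto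
  finally show ?thesis by (simp only: mult_ac)
\<comment> \<open>At \<open>s = 0\<close> the left side is 0 by the convention
  \<open>0 powr _ = 0\<close>.\<close>
qed (use assms in simp)

text \<open>Half of the exponential rate of \<open>g\<close> pays for the factor
  \<open>1 + t\<close> of the splitting, and the other half keeps the remaining integral finite,
  uniformly in \<open>x\<close>.\<close>

lemma RL_integral_le:
  fixes d c C :: real
  assumes d: "0 < d" "d < 1" and c: "0 < c" and C: "0 < C"
    and g0: "\<forall>t<0. g t = 0" and g: "\<forall>t. \<bar>g t\<bar> \<le> C * exp (- c * t)"
  obtains K where "0 \<le> K" "\<And>x. 0 \<le> x \<Longrightarrow> \<bar>RL_integral d g x\<bar> \<le> K * (1 + x) powr (d - 1)"
proof
  \<comment> \<open>The factor \<open>1 + 2 / c\<close> comes from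
    \<open>1 + t \<le> (1 + 2 / c) * exp ((c/2) * t)\<close>. In \<open>K\<close>,
    \<open>2 / c\<close> and \<open>1 / d\<close> are the integrals of
    \<open>exp (- (c/2) * t)\<close> over the half line and of \<open>s powr (d - 1)\<close> over
    the unit interval.\<close>
  define D where "D = 2 * C * (1 + 2 / c)"
  define K where "K = \<bar>1 / Gamma d\<bar> * (D * (2 / c + 1 / d))"
  show "0 \<le> K" using d c C by (simp add: K_def D_def)
  have "D \<ge> 0" using c C by (simp add: D_def)
  have "((\<lambda>t. exp (- (c/2) * t)) has_integral exp (- (c/2) * 0) / (c/2)) {0..}"
    using c by (intro has_integral_exp_minus_to_infinity) auto
  then have "has_bochner_integral lborel (\<lambda>t. indicator {0..} t * exp (- (c/2) * t)) (exp (- (c/2) * 0) / (c/2))"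
    by (rule has_bochner_integral_lborel_nonneg) auto
  then have int_exp: "has_bochner_integral lborel (\<lambda>t. indicator {0..} t * exp (- (c/2) * t)) (2 / c)"
    by simp
  have "((\<lambda>s. s powr (d - 1)) has_integral 1 powr (d - 1 + 1) / (d - 1 + 1)) {0..1}"
    using d by (intro has_integral_powr_from_0) auto
  then have "has_bochner_integral lborel (\<lambda>s. indicator {0..1} s * s powr (d - 1)) (1 powr (d - 1 + 1) / (d - 1 + 1))"
    by (rule has_bochner_integral_lborel_nonneg) auto
  then have pow: "has_bochner_integral lborel (\<lambda>s. indicator {0..1} s * s powr (d - 1)) (1 / d)"
    by simp
  have int_powr: "has_bochner_integral lborel (\<lambda>t. indicator {0..1} (x - t) * (x - t) powr (d - 1)) (1 / d)" for x
    using pow lborel_integrable_real_affine[of "\<lambda>s. indicator {0..1} s * s powr (d - 1)" "-1" x]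
      lborel_integral_real_affine[of "-1" "\<lambda>s. indicator {0..1} s * s powr (d - 1)" x]
    by (simp add: has_bochner_integral_iff)
  fix x :: real
  assume "0 \<le> x"
  define f where "f = (\<lambda>t. indicator {..x} t *\<^sub>R (g t * (x - t) powr (d - 1)))"
  define B where "B = (\<lambda>t. (1 + x) powr (d - 1) * (D *
    (indicator {0..} t * exp (- (c/2) * t) + indicator {0..1} (x - t) * (x - t) powr (d - 1))))"
  have "has_bochner_integral lborel B ((1 + x) powr (d - 1) * (D * (2 / c + 1 / d)))"
    unfolding B_def by (intro has_bochner_integral_mult_right has_bochner_integral_add int_exp int_powr)
  then have "integrable lebesgue B" "(\<integral>t. B t \<partial>lebesgue) = (1 + x) powr (d - 1) * (D * (2 / c + 1 / d))"
    by (auto simp: has_bochner_integral_iff integrable_completion integral_completion)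
  have B_nn: "0 \<le> B t" for t using \<open>D \<ge> 0\<close> by (simp add: B_def)
  have fB: "\<bar>f t\<bar> \<le> B t" for t
  proof (cases "0 \<le> t \<and> t \<le> x")
    case True
    have "1 + t \<le> (1 + 2 / c) * (1 + (c/2) * t)" using c True by (simp add: field_simps)
    also have "\<dots> \<le> (1 + 2 / c) * exp ((c/2) * t)" using c by (intro mult_left_mono exp_ge_add_one_self) auto
    finally have "(1 + t) * exp (- c * t) \<le> (1 + 2 / c) * exp ((c/2) * t) * exp (- c * t)"
      by (rule mult_right_mono) auto
    also have "\<dots> = (1 + 2 / c) * exp (- (c/2) * t)" by (simp add: exp_add[symmetric])
    finally have e: "2 * C * ((1 + t) * exp (- c * t)) \<le> D * exp (- (c/2) * t)"
      using C by (simp add: D_def)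
    have e1: "exp (- (c/2) * t) \<le> 1" using c True by simp
    define q where "q = indicator {0..1} (x - t) * (x - t) powr (d - 1)"
    have "q \<ge> 0" by (simp add: q_def)
    have "\<bar>f t\<bar> = \<bar>g t\<bar> * (x - t) powr (d - 1)" using True by (simp add: f_def abs_mult)
    also have "\<dots> \<le> (C * exp (- c * t)) * ((1 + x) powr (d - 1) * (2 * (1 + t) * (1 + q)))"
      using g powr_convolution_split[OF d, of "x - t" t] True C
      unfolding q_def by (intro mult_mono) auto
    also have "\<dots> = (1 + x) powr (d - 1) * ((2 * C * ((1 + t) * exp (- c * t))) * (1 + q))"
      by (simp only: mult_ac)
    also have "\<dots> \<le> (1 + x) powr (d - 1) * ((D * exp (- (c/2) * t)) * (1 + q))"
      using e \<open>q \<ge> 0\<close> by (intro mult_left_mono mult_right_mono) auto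
    \<comment> \<open>Dropping the exponential in front of \<open>q\<close> turns the product into a
      sum whose two terms integrate separately.\<close>
    also have "\<dots> \<le> (1 + x) powr (d - 1) * (D * (exp (- (c/2) * t) + q))"
      unfolding mult.assoc using \<open>D \<ge> 0\<close> \<open>q \<ge> 0\<close> mult_right_mono[OF e1 \<open>q \<ge> 0\<close>]
      by (intro mult_left_mono) (auto simp: ring_distribs)
    also have "\<dots> = B t" using True by (simp add: B_def q_def)
    finally show ?thesis .
  qed (use g0 B_nn in \<open>auto simp: f_def not_le\<close>)
  \<comment> \<open>If \<open>f\<close> is not integrable, its integral is 0 by convention and the
    bound follows from \<open>B \<ge> 0\<close>.\<close>
  have "\<bar>\<integral>t. f t \<partial>lebesgue\<bar> \<le> (\<integral>t. B t \<partial>lebesgue)"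
  proof (cases "integrable lebesgue f")
    case True
    then show ?thesis by (intro integral_abs_bound_integral fB \<open>integrable lebesgue B\<close>)
  qed (simp add: not_integrable_integral_eq B_nn)
  then have "\<bar>1 / Gamma d\<bar> * \<bar>\<integral>t. f t \<partial>lebesgue\<bar> \<le> \<bar>1 / Gamma d\<bar> * (\<integral>t. B t \<partial>lebesgue)"
    by (intro mult_left_mono) auto
  then show "\<bar>RL_integral d g x\<bar> \<le> K * (1 + x) powr (d - 1)"
    unfolding \<open>(\<integral>t. B t \<partial>lebesgue) = _\<close>
    by (simp add: RL_integral_def set_lebesgue_integral_def f_def K_def abs_mult mult_ac)
qed

subsection \<open>Linearity of the stable integral\<close>

text \<open>A sum is at most twice the larger of its terms in absolute value, which gives a majorant
  for every positive \<open>p\<close> without convexity.\<close>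

lemma Lp_fun_linear_combination:
  assumes "f \<in> Lp_fun N p" "h \<in> Lp_fun N p" "0 < p"
  shows "(\<lambda>x. a * f x + b * h x) \<in> Lp_fun N p"
proof -
  have [measurable]: "f \<in> borel_measurable N" "h \<in> borel_measurable N"
    and int: "integrable N (\<lambda>x. \<bar>f x\<bar> powr p)" "integrable N (\<lambda>x. \<bar>h x\<bar> powr p)"
    using assms by (auto simp: Lp_fun_def)
  have "integrable N (\<lambda>x. \<bar>a * f x + b * h x\<bar> powr p)"
  proof (rule Bochner_Integration.integrable_bound)
    show "integrable N (\<lambda>x. \<bar>2 * a\<bar> powr p * \<bar>f x\<bar> powr p + \<bar>2 * b\<bar> powr p * \<bar>h x\<bar> powr p)"
      using int by (intro Bochner_Integration.integrable_add integrable_mult_right)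
    show "AE x in N. norm (\<bar>a * f x + b * h x\<bar> powr p)
        \<le> norm (\<bar>2 * a\<bar> powr p * \<bar>f x\<bar> powr p + \<bar>2 * b\<bar> powr p * \<bar>h x\<bar> powr p)"
    proof (rule AE_I2)
      fix x
      have "\<bar>a * f x + b * h x\<bar> powr p \<le> max \<bar>2 * a * f x\<bar> \<bar>2 * b * h x\<bar> powr p"
        using assms by (intro powr_mono2) auto
      also have "\<dots> \<le> \<bar>2 * a * f x\<bar> powr p + \<bar>2 * b * h x\<bar> powr p"
        by (auto simp: max_def)
      finally show "norm (\<bar>a * f x + b * h x\<bar> powr p)
        \<le> norm (\<bar>2 * a\<bar> powr p * \<bar>f x\<bar> powr p + \<bar>2 * b\<bar> powr p * \<bar>h x\<bar> powr p)"
        by (simp add: abs_mult powr_mult)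
    qed
  qed measurable
  then show ?thesis by (simp add: Lp_fun_def)
qed

lemma stable_integral_average:
  assumes J: "stable_integral M \<alpha> L J" and "0 < \<alpha>"
    and f: "\<And>j. f j \<in> Lp_fun lebesgue \<alpha>"
  shows "(\<lambda>x. (\<Sum>j=1..n. f j x) / real n) \<in> Lp_fun lebesgue \<alpha>"
    and "AE \<omega> in M. J (\<lambda>x. (\<Sum>j=1..n. f j x) / real n) \<omega> = (\<Sum>j=1..n. J (f j) \<omega>) / real n"
proof -
  have lin: "AE \<omega> in M. J (\<lambda>x. a * u x + b * h x) \<omega> = a * J u \<omega> + b * J h \<omega>"
    if "u \<in> Lp_fun lebesgue \<alpha>" "h \<in> Lp_fun lebesgue \<alpha>" for u h a b
    using J that by (simp add: stable_integral_def)
  have zero: "(\<lambda>_. 0) \<in> Lp_fun lebesgue \<alpha>" by (simp add: Lp_fun_def)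
  have sum: "(\<lambda>x. \<Sum>j=1..n. f j x) \<in> Lp_fun lebesgue \<alpha> \<and>
      (AE \<omega> in M. J (\<lambda>x. \<Sum>j=1..n. f j x) \<omega> = (\<Sum>j=1..n. J (f j) \<omega>))"
  proof (induction n)
    case 0
    \<comment> \<open>Linearity with both coefficients 0 shows that the integral of the zero
      function is almost surely 0.\<close>
    show ?case using zero lin[OF zero zero, of 0 0] by simp
  next
    case (Suc n)
    then have *: "(\<lambda>x. \<Sum>j=1..n. f j x) \<in> Lp_fun lebesgue \<alpha>"
      and IH: "AE \<omega> in M. J (\<lambda>x. \<Sum>j=1..n. f j x) \<omega> = (\<Sum>j=1..n. J (f j) \<omega>)" by auto
    have "AE \<omega> in M. J (\<lambda>x. \<Sum>j=1..Suc n. f j x) \<omega> = (\<Sum>j=1..Suc n. J (f j) \<omega>)"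
      using lin[OF * f[of "Suc n"], of 1 1] IH by eventually_elim simp
    moreover have "(\<lambda>x. \<Sum>j=1..Suc n. f j x) \<in> Lp_fun lebesgue \<alpha>"
      using Lp_fun_linear_combination[OF * f[of "Suc n"] \<open>0 < \<alpha>\<close>, of 1 1] by simp
    ultimately show ?case by blast
  qed
  then have *: "(\<lambda>x. \<Sum>j=1..n. f j x) \<in> Lp_fun lebesgue \<alpha>" ..
  show "(\<lambda>x. (\<Sum>j=1..n. f j x) / real n) \<in> Lp_fun lebesgue \<alpha>"
    using Lp_fun_linear_combination[OF * zero \<open>0 < \<alpha>\<close>, of "1 / real n" 0] by simp
  have "AE \<omega> in M. J (\<lambda>x. \<Sum>j=1..n. f j x) \<omega> = (\<Sum>j=1..n. J (f j) \<omega>)" using sum ..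
  then show "AE \<omega> in M. J (\<lambda>x. (\<Sum>j=1..n. f j x) / real n) \<omega> = (\<Sum>j=1..n. J (f j) \<omega>) / real n"
    using lin[OF * zero, of "1 / real n" 0] by eventually_elim simp
qed

text \<open>The characteristic function of \<open>J h\<close> is that of a symmetric stable variable
  whose scale is the \<open>L^\<alpha>\<close> norm of \<open>h\<close>. The constant
  \<open>K\<close> is the same for all \<open>h\<close>.\<close>

lemma stable_integral_abs_moment:
  assumes "prob_space M" and J: "stable_integral M \<alpha> L J" and p: "0 < p" "p < \<alpha>"
    and h: "h \<in> Lp_fun lebesgue \<alpha>"
  defines "K \<equiv> (1 / (\<alpha> - p) + 1 / p) / ((1 - cos 1) * 2 powr (- p - 1))"
  shows "integrable M (\<lambda>\<omega>. \<bar>J h \<omega>\<bar> powr p)"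
    and "(\<integral>\<omega>. \<bar>J h \<omega>\<bar> powr p \<partial>M) \<le> K * (\<integral>x. \<bar>h x\<bar> powr \<alpha> \<partial>lebesgue) powr (p / \<alpha>)"
proof -
  interpret prob_space M by fact
  define \<sigma> where "\<sigma> = (\<integral>x. \<bar>h x\<bar> powr \<alpha> \<partial>lebesgue) powr (1 / \<alpha>)"
  have X: "J h \<in> borel_measurable M" using J h by (simp add: stable_integral_def)
  have "\<sigma> powr \<alpha> = (\<integral>x. \<bar>h x\<bar> powr \<alpha> \<partial>lebesgue)"
    using p by (simp add: \<sigma>_def powr_powr)
  then have char: "(\<integral>\<omega>. iexp (\<theta> * J h \<omega>) \<partial>M) = complex_of_real (exp (- (\<bar>\<theta>\<bar> powr \<alpha> * \<sigma> powr \<alpha>)))" for \<theta>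
    using J h by (simp add: stable_integral_def)
  have "\<sigma> \<ge> 0" by (simp add: \<sigma>_def)
  note m = SaS_abs_moment[OF X p this char]
  show "integrable M (\<lambda>\<omega>. \<bar>J h \<omega>\<bar> powr p)" by (rule m)
  show "(\<integral>\<omega>. \<bar>J h \<omega>\<bar> powr p \<partial>M) \<le> K * (\<integral>x. \<bar>h x\<bar> powr \<alpha> \<partial>lebesgue) powr (p / \<alpha>)"
    using m(2) by (simp add: K_def \<sigma>_def powr_powr)
qed

section \<open>The law of large numbers in the mean of order \<open>p\<close>\<close>

theorem theorem4p5:
  fixes M :: "'a measure"
    and \<alpha> d p C c :: real
    and L :: "real \<Rightarrow> 'a \<Rightarrow> real"
    and J :: "(real \<Rightarrow> real) \<Rightarrow> 'a \<Rightarrow> real"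
    and g :: "real \<Rightarrow> real"
  assumes "prob_space M"
    and "1 < \<alpha>" and "\<alpha> < 2"
    and "SaS_process M \<alpha> L"
    and "stable_integral M \<alpha> L J"
    and "0 < d" and "d < 1 - 1 / \<alpha>"
    and "1 < p" and "p < \<alpha>"
    and "g \<in> borel_measurable lebesgue"
    and "\<forall>t<0. g t = 0"
    and "C > 0" and "c > 0"
    and "\<forall>t. \<bar>g t\<bar> \<le> C * exp (- c * t)"
  shows "tendsto_Lp M p
           (\<lambda>n \<omega>. (\<Sum>j=1..n. FIMA_stable J d g (real j) \<omega>) / real n) (\<lambda>_. 0)"
proof -
  define k where "k = RL_integral d g"
  define h where "h = (\<lambda>n x. (\<Sum>j=1..n. k (real j - x)) / real n)"
  define S where "S = (\<lambda>n \<omega>. (\<Sum>j=1..n. FIMA_stable J d g (real j) \<omega>) / real n)"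
  define E where "E = (\<lambda>n. \<integral>x. \<bar>h n x\<bar> powr \<alpha> \<partial>lebesgue)"
  have "1 / \<alpha> > 0" using assms by simp
  then have "d < 1" using assms by linarith
  \<comment> \<open>This is \<open>d < 1 - 1 / \<alpha>\<close> rearranged: the decay exponent
    \<open>1 - d\<close> of the kernel is large enough for \<open>L^\<alpha>\<close>.\<close>
  have d\<alpha>: "1 < (1 - d) * \<alpha>" using assms by (simp add: field_simps)
  have k_borel[measurable]: "k \<in> borel_measurable borel"
    unfolding k_def using assms by (intro borel_measurable_RL_integral)
  have k_neg: "k u = 0" if "u < 0" for u
    unfolding k_def using assms that by (intro RL_integral_neg)
  obtain K where K: "0 \<le> K" "\<And>u. 0 \<le> u \<Longrightarrow> \<bar>k u\<bar> \<le> K * (1 + u) powr - (1 - d)"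
    unfolding k_def minus_diff_eq
    by (rule RL_integral_le[OF \<open>0 < d\<close> \<open>d < 1\<close> \<open>c > 0\<close> \<open>C > 0\<close> assms(11,14)]) blast
  note kernel = k_borel k_neg K(2,1)
  \<comment> \<open>The indicator in the moving average is redundant because the kernel vanishes on
    the negative axis.\<close>
  have fima: "FIMA_stable J d g t = J (\<lambda>x. k (t - x))" for t
  proof -
    have "(\<lambda>x. indicator {..t} x * RL_integral d g (t - x)) = (\<lambda>x. k (t - x))"
      using k_neg by (auto simp: fun_eq_iff k_def indicator_def)
    then show ?thesis by (simp add: FIMA_stable_def)
  qed
  have "integrable lborel (\<lambda>u. \<bar>k u\<bar> powr \<alpha>)"
    using kernel \<open>d < 1\<close> d\<alpha> assms by (intro integrable_kernel_powr[of k K "1 - d"]) auto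
  then have "integrable lborel (\<lambda>x. \<bar>k (t - x)\<bar> powr \<alpha>)" for t
    using lborel_integrable_real_affine[of "\<lambda>u. \<bar>k u\<bar> powr \<alpha>" "-1" t] by simp
  then have k_Lp: "(\<lambda>x. k (real j - x)) \<in> Lp_fun lebesgue \<alpha>" for j
    by (auto simp: Lp_fun_def integrable_completion intro!: measurable_completion)
  have h_Lp: "h n \<in> Lp_fun lebesgue \<alpha>" for n
    unfolding h_def using stable_integral_average(1)[OF assms(5) _ k_Lp] assms by simp
  have JS: "AE \<omega> in M. J (h n) \<omega> = S n \<omega>" for n
    unfolding h_def S_def fima using stable_integral_average(2)[OF assms(5) _ k_Lp] assms by simp
  have J_meas: "J f \<in> borel_measurable M" if "f \<in> Lp_fun lebesgue \<alpha>" for f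
    using assms(5) that by (simp add: stable_integral_def)
  have [measurable]: "S n \<in> borel_measurable M" for n
    unfolding S_def fima using J_meas[OF k_Lp] by measurable
  have [measurable]: "J (h n) \<in> borel_measurable M" for n
    by (rule J_meas) (rule h_Lp)
  have "0 < p" using \<open>1 < p\<close> by simp
  note moment = stable_integral_abs_moment[OF \<open>prob_space M\<close> assms(5) this \<open>p < \<alpha>\<close> h_Lp]
  \<comment> \<open>One constant serves all \<open>n\<close>, so the moments of the averages are
    controlled by \<open>E\<close> alone.\<close>
  obtain Kp where Kp: "\<And>n. (\<integral>\<omega>. \<bar>J (h n) \<omega>\<bar> powr p \<partial>M) \<le> Kp * E n powr (p / \<alpha>)"
    using moment(2) unfolding E_def by blast
  have S_int: "integrable M (\<lambda>\<omega>. \<bar>S n \<omega>\<bar> powr p)" for n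
    by (rule integrable_cong_AE_imp[OF moment(1)[of n]]) (use JS[of n] in \<open>auto elim!: eventually_mono\<close>)
  have S_le: "(\<integral>\<omega>. \<bar>S n \<omega>\<bar> powr p \<partial>M) \<le> Kp * E n powr (p / \<alpha>)" for n
  proof -
    have "(\<integral>\<omega>. \<bar>S n \<omega>\<bar> powr p \<partial>M) = (\<integral>\<omega>. \<bar>J (h n) \<omega>\<bar> powr p \<partial>M)"
      by (rule integral_cong_AE) (use JS[of n] in \<open>auto elim!: eventually_mono\<close>)
    with Kp show ?thesis by simp
  qed
  have "E n = (\<integral>x. \<bar>(\<Sum>j=1..n. k (real j - x)) / real n\<bar> powr \<alpha> \<partial>lborel)" for n
    unfolding E_def h_def by (intro integral_completion) measurable
  moreover have "(\<lambda>n. \<integral>x. \<bar>(\<Sum>j=1..n. k (real j - x)) / real n\<bar> powr \<alpha> \<partial>lborel) \<longlonglongrightarrow> 0"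
    using kernel \<open>d < 1\<close> d\<alpha> assms by (intro average_translates_tendsto_0[of k K "1 - d"]) auto
  ultimately have "E \<longlonglongrightarrow> 0" by presburger
  then have "(\<lambda>n. Kp * E n powr (p / \<alpha>)) \<longlonglongrightarrow> 0"
    using assms by (intro tendsto_eq_intros | simp add: E_def)+
  then have "(\<lambda>n. \<integral>\<omega>. \<bar>S n \<omega>\<bar> powr p \<partial>M) \<longlonglongrightarrow> 0"
    by (rule real_tendsto_sandwich[OF _ _ tendsto_const, rotated 2]) (auto simp: S_le)
  then have "(\<lambda>n. (\<integral>\<omega>. \<bar>S n \<omega>\<bar> powr p \<partial>M) powr (1 / p)) \<longlonglongrightarrow> 0"
    using assms by (intro tendsto_eq_intros | simp)+
  then show ?thesis
    using S_int unfolding S_def[symmetric] tendsto_Lp_def by (simp add: Lp_fun_def)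
qed

end
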